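(* Let $\mathcal{X}\subseteq\mathbb{R}^d$ be a nonempty closed convex set and let $V:\mathcal{X}\to\mathbb{R}^d$ be monotone, i.e. $\langle V(x)-V(x'),x-x'\rangle\ge 0$ for all $x,x'\in\mathcal{X}$. Let $\mathcal{C}\subseteq\mathcal{X}$ be a convex compact neighborhood (in $\mathcal{X}$) of a solution of the variational inequality (VI) associated with $V$ and $\mathcal{X}$, and let $H=\sup_{x\in\mathcal{C}}\|X_1-x\|^2$. If the extra-gradient algorithm with the adaptive step-size described in the context is run from an initial point $X_1\in\mathcal{X}$, then its ergodic average $\bar X_T$ satisfies the following. (a) If there is $M>0$ such that $\|V(x)\|\le M$ for all $x\in\mathcal{X}$, then $$\mathrm{Gap}_{\mathcal{C}}(\bar X_T)=\mathcal{O}\left(\frac{H+4M^3+\log(1+4M^2T)}{\sqrt{T}}\right).$$ (b) If there is $L>0$ such that $\|V(x)-V(x')\|\le L\|x-x'\|$ for all $x,x'\in\mathcal{X}$, then $$\mathrm{Gap}_{\mathcal{C}}(\bar X_T)=\mathcal{O}\left(H/T\right).$$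
   Context: Here $\|\cdot\|$ is the Euclidean norm on $\mathbb{R}^d$. Variational inequality (VI): a solution is a point $x^*\in\mathcal{X}$ such that $\langle V(x^* ),x-x^*\rangle\ge 0$ for all $x\in\mathcal{X}$. Restricted merit function: for a nonempty convex $\mathcal{C}\subseteq\mathcal{X}$ and $\hat x\in\mathcal{X}$, $\mathrm{Gap}_{\mathcal{C}}(\hat x)=\sup_{x\in\mathcal{C}}\langle V(x),\hat x-x\rangle$. Extra-gradient algorithm with adaptive step-size: let $\Pi(x)=\arg\min_{x'\in\mathcal{X}}\|x'-x\|$ be the Euclidean projection on $\mathcal{X}$. Starting from $X_1\in\mathcal{X}$, for $t=1,2,\dots$ set $$X_{t+1/2}=\Pi(X_t-\gamma_t V(X_t)),\qquad X_{t+1}=\Pi(X_t-\gamma_t V(X_{t+1/2})),$$ where $\gamma_1=1$ and $\gamma_{t+1}=1/\sqrt{1+\sum_{s=1}^{t}\delta_s^2}$ with $\delta_t=\|V(X_{t+1/2})-V(X_t)\|$. Ergodic average: $\bar X_T=\sum_{t=1}^{T}\gamma_tX_{t+1/2}\big/\sum_{t=1}^{T}\gamma_t$. The notation $\mathcal{O}(\cdot)$ refers to $T\to\infty$; the implied multiplicative constant does not depend on $T$ but may depend on the problem's data (e.g. on $M$, $L$). *)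

theory Defs
  imports "HOL-Analysis.Analysis" "HOL-Library.Landau_Symbols"
begin

definition monotone_operator_on :: "'a::real_inner set \<Rightarrow> ('a \<Rightarrow> 'a) \<Rightarrow> bool" where
  "monotone_operator_on \<X> V \<longleftrightarrow> (\<forall>x\<in>\<X>. \<forall>x'\<in>\<X>. (V x - V x') \<bullet> (x - x') \<ge> 0)"

definition VI_solution :: "('a::real_inner \<Rightarrow> 'a) \<Rightarrow> 'a set \<Rightarrow> 'a \<Rightarrow> bool" where
  "VI_solution V \<X> xs \<longleftrightarrow> xs \<in> \<X> \<and> (\<forall>x\<in>\<X>. V xs \<bullet> (x - xs) \<ge> 0)"

(* A supremum in the reals. It is finite whenever \<C> is a nonempty bounded subset of \<X>, V is
   monotone on \<X> and xh \<in> \<X>, since then V x \<bullet> (xh - x) \<le> V xh \<bullet> (xh - x). *)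
definition Gap :: "('a::real_inner \<Rightarrow> 'a) \<Rightarrow> 'a set \<Rightarrow> 'a \<Rightarrow> real" where
  "Gap V \<C> xh = (SUP x\<in>\<C>. V x \<bullet> (xh - x))"

(* Indices start at 1: x t, y t and \<gamma> t stand for X_t, X_{t+1/2} and \<gamma>_t.
   The values at index 0 play no role. *)
definition adaptive_extragradient ::
  "('a::euclidean_space \<Rightarrow> 'a) \<Rightarrow> 'a set \<Rightarrow> (nat \<Rightarrow> 'a) \<Rightarrow> (nat \<Rightarrow> 'a) \<Rightarrow> (nat \<Rightarrow> real) \<Rightarrow> bool" where
  "adaptive_extragradient V \<X> x y \<gamma> \<longleftrightarrow>
     x 1 \<in> \<X> \<and> \<gamma> 1 = 1 \<and>
     (\<forall>t\<ge>1. y t = closest_point \<X> (x t - \<gamma> t *\<^sub>R V (x t)) \<and>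
            x (t + 1) = closest_point \<X> (x t - \<gamma> t *\<^sub>R V (y t)) \<and>
            \<gamma> (t + 1) = 1 / sqrt (1 + (\<Sum>s=1..t. (norm (V (y s) - V (x s)))\<^sup>2)))"

definition ergodic_average :: "(nat \<Rightarrow> real) \<Rightarrow> (nat \<Rightarrow> 'a::real_vector) \<Rightarrow> nat \<Rightarrow> 'a" where
  "ergodic_average \<gamma> y T = (\<Sum>t=1..T. \<gamma> t *\<^sub>R y t) /\<^sub>R (\<Sum>t=1..T. \<gamma> t)"

end

theory Submission
  imports Defs
begin

text \<open>
  Write $\delta_t = \|V(X_{t+1/2}) - V(X_t)\|$ and $S_t = \sum_{s \le t} \delta_s^2$. The
  variational characterisation of the two projections gives, for every $z \in \mathcal{X}$,
  \[ \|X_{t+1} - z\|^2 + 2\gamma_t \langle V(X_{t+1/2}), X_{t+1/2} - z\rangle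
     \le \|X_t - z\|^2 + \gamma_t^2\delta_t^2 - \|X_t - X_{t+1/2}\|^2 . \]
  Summing and using monotonicity, the gap at $\bar X_T$ is at most
  $(H + \sum_{t \le T} \gamma_t^2\delta_t^2) / (2\sum_{t \le T}\gamma_t)$.
  If $V$ is bounded, $\sum \gamma_t^2\delta_t^2 = \sum \delta_t^2/(1 + S_{t-1})$ grows
  logarithmically and $\gamma_t$ decays at most like $1/\sqrt t$. If $V$ is Lipschitz,
  $\|X_t - X_{t+1/2}\| \ge \delta_t / L$, and the summed inequality at a solution $z$ reads
  $\sum (1/L^2 - \gamma_t^2)\delta_t^2 \le \|X_1 - z\|^2$. Were $S_t$ unbounded, $\gamma_t$ would
  tend to $0$ and this would bound $S_t$; so $S_t$ is bounded and $\gamma_t$ stays away from $0$.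
  When $H = 0$ the bound $O(H/T)$ demands a vanishing gap: then $\mathcal{C}$ is a single point
  that is open in the connected set $\mathcal{X}$, so $\mathcal{X}$ is that point.
\<close>

section \<open>One-step inequality and auxiliary facts\<close>

lemma extragradient_step:
  fixes X :: "'a::euclidean_space set"
  assumes "closed X" "convex X" "a \<in> X" "z \<in> X"
    and y: "y = closest_point X (a - g *\<^sub>R u)"
    and b: "b = closest_point X (a - g *\<^sub>R v)"
  shows "(norm (b - z))\<^sup>2 + 2 * (g * (v \<bullet> (y - z)))
           \<le> (norm (a - z))\<^sup>2 + g\<^sup>2 * (norm (v - u))\<^sup>2 - (norm (a - y))\<^sup>2"
proof -
  have "b \<in> X"
    using assms closest_point_in_set[of X] by auto
  have 1: "(a - g *\<^sub>R v - b) \<bullet> (z - b) \<le> 0"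
    unfolding b using assms by (intro closest_point_dot) auto
  have 2: "(a - g *\<^sub>R u - y) \<bullet> (b - y) \<le> 0"
    unfolding y using assms \<open>b \<in> X\<close> by (intro closest_point_dot) auto
  \<comment> \<open>Twice \<open>1\<close> plus twice \<open>2\<close> leaves a cross term between
    \<open>v - u\<close> and \<open>b - y\<close> together with the negative of the squared norm of
    \<open>b - y\<close>. Expanding this square bounds the two by the squared norm of
    \<open>g *\<^sub>R (v - u)\<close>.\<close>
  have 3: "0 \<le> (g *\<^sub>R (v - u) + (b - y)) \<bullet> (g *\<^sub>R (v - u) + (b - y))"
    by simp
  show ?thesis
    using 1 2 3 unfolding power2_norm_eq_inner
    by (simp add: inner_simps inner_commute algebra_simps power2_eq_square)
qed

text \<open>The denominator lags one increment behind. Concavity of the logarithm handles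
  \<open>d / (1 + S + d)\<close>, and \<open>d \<le> K\<close> makes the passage from
  \<open>1 + S\<close> to \<open>1 + S + d\<close> cost at most a factor
  \<open>1 + K\<close>.\<close>

lemma relative_increment_le_ln:
  fixes S K d :: real
  assumes "0 \<le> S" "0 \<le> d" "d \<le> K"
  shows "d / (1 + S) \<le> (1 + K) * (ln (1 + S + d) - ln (1 + S))"
proof -
  have "0 \<le> K * S"
    using assms by (intro mult_nonneg_nonneg) auto
  moreover have "(1 + K) * (1 + S) = 1 + K + S + K * S"
    by (simp add: algebra_simps)
  ultimately have "1 + S + d \<le> (1 + K) * (1 + S)"
    using assms by linarith
  then have "d * (1 + S + d) \<le> d * ((1 + K) * (1 + S))"
    using assms by (intro mult_left_mono)
  then have "d / (1 + S) \<le> (1 + K) * (d / (1 + S + d))"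
    using assms by (simp add: field_simps)
  also have "\<dots> \<le> (1 + K) * (ln (1 + S + d) - ln (1 + S))"
  proof (rule mult_left_mono)
    have "ln (1 + S) - ln (1 + S + d) \<le> ((1 + S) - (1 + S + d)) / (1 + S + d)"
      using assms by (intro ln_diff_le) auto
    then show "d / (1 + S + d) \<le> ln (1 + S + d) - ln (1 + S)"
      by simp
  qed (use assms in auto)
  finally show ?thesis .
qed

text \<open>The logarithms telescope. The inner sum stops at \<open>t-1\<close> because each step
  size is fixed before the increment of its own step is known.\<close>

lemma sum_relative_increments_le_ln:
  fixes d :: "nat \<Rightarrow> real"
  assumes "\<And>t. t \<ge> 1 \<Longrightarrow> 0 \<le> d t \<and> d t \<le> K"
  shows "(\<Sum>t=1..T. d t / (1 + (\<Sum>s=1..t-1. d s))) \<le> (1 + K) * ln (1 + (\<Sum>s=1..T. d s))"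
proof (induction T)
  case (Suc T)
  have "0 \<le> (\<Sum>s=1..T. d s)"
    using assms by (intro sum_nonneg) auto
  then have "d (Suc T) / (1 + (\<Sum>s=1..T. d s))
      \<le> (1 + K) * (ln (1 + (\<Sum>s=1..T. d s) + d (Suc T)) - ln (1 + (\<Sum>s=1..T. d s)))"
    using assms[of "Suc T"] by (intro relative_increment_le_ln) auto
  with Suc show ?case
    by (simp add: algebra_simps)
qed simp

lemma interior_of_singleton_convex:
  fixes X :: "'a::real_normed_vector set"
  assumes "convex X" "a \<in> top_of_set X interior_of {a}"
  shows "X = {a}"
proof -
  have "openin (top_of_set X) (top_of_set X interior_of {a})"
    by simp
  moreover have "top_of_set X interior_of {a} = {a}"
    using assms(2) interior_of_subset[of "top_of_set X" "{a}"] by blast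
  ultimately have op: "openin (top_of_set X) {a}"
    by simp
  then have "closedin (top_of_set X) {a}"
    using openin_imp_subset by (fastforce intro: closed_subset)
  with op show ?thesis
    using convex_connected[OF assms(1)] unfolding connected_clopen by blast
qed

text \<open>Compactness makes the image bounded above, so that the real supremum is a genuine
  one.\<close>

lemma norm_le_SUP_on_compact:
  fixes C :: "'a::real_normed_vector set"
  assumes "compact C" "z \<in> C"
  shows "(norm (a - z))\<^sup>2 \<le> (SUP w\<in>C. (norm (a - w))\<^sup>2)"
proof -
  have "compact ((\<lambda>w. (norm (a - w))\<^sup>2) ` C)"
    using assms by (intro compact_continuous_image continuous_intros)
  then show ?thesis
    using assms by (intro cSUP_upper bounded_imp_bdd_above compact_imp_bounded)
qed

section \<open>Iterates and step sizes of a run\<close>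

locale adaptive_extragradient_run =
  fixes X :: "'a::euclidean_space set" and V :: "'a \<Rightarrow> 'a"
    and x y :: "nat \<Rightarrow> 'a" and \<gamma> :: "nat \<Rightarrow> real"
  assumes closed_X: "closed X" and convex_X: "convex X"
    and mono_V: "monotone_operator_on X V"
    and run: "adaptive_extragradient V X x y \<gamma>"
begin

definition \<delta> :: "nat \<Rightarrow> real" where
  "\<delta> t = norm (V (y t) - V (x t))"

definition S :: "nat \<Rightarrow> real" where
  "S T = (\<Sum>t=1..T. (\<delta> t)\<^sup>2)"

lemma S_nonneg: "0 \<le> S T"
  unfolding S_def by (intro sum_nonneg) auto

lemma S_mono: "m \<le> n \<Longrightarrow> S m \<le> S n"
  unfolding S_def by (intro sum_mono2) auto

lemma x_in: "t \<ge> 1 \<Longrightarrow> x t \<in> X"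
proof (induction t rule: dec_induct)
  case base
  show ?case using run by (simp add: adaptive_extragradient_def)
next
  case (step t)
  then have "x (t + 1) = closest_point X (x t - \<gamma> t *\<^sub>R V (y t))"
    using run by (simp add: adaptive_extragradient_def)
  then show ?case
    using step closest_point_in_set[OF closed_X] by auto
qed

lemma y_in: "t \<ge> 1 \<Longrightarrow> y t \<in> X"
  using run closest_point_in_set[OF closed_X] x_in[of t]
  by (auto simp: adaptive_extragradient_def)

text \<open>The empty sum \<open>S 0 = 0\<close> absorbs the initial condition
  \<open>\<gamma> 1 = 1\<close>, so one formula covers every step.\<close>

lemma step_size: "t \<ge> 1 \<Longrightarrow> \<gamma> t = 1 / sqrt (1 + S (t - 1))"
proof (cases t)
  case (Suc n)
  show ?thesis
    using run Suc by (cases n) (auto simp: adaptive_extragradient_def S_def \<delta>_def)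
qed simp

lemma step_size_pos: "t \<ge> 1 \<Longrightarrow> 0 < \<gamma> t"
  using S_nonneg[of "t - 1"] by (simp add: step_size)

lemma step_size_squared: "t \<ge> 1 \<Longrightarrow> (\<gamma> t)\<^sup>2 = 1 / (1 + S (t - 1))"
  using S_nonneg[of "t - 1"] by (simp add: step_size power_divide)

lemma step_size_squared_le_1: "t \<ge> 1 \<Longrightarrow> (\<gamma> t)\<^sup>2 \<le> 1"
  using S_nonneg[of "t - 1"] by (simp add: step_size_squared)

lemma step_size_ge:
  assumes "t \<ge> 1" "S (t - 1) \<le> B"
  shows "1 / sqrt (1 + B) \<le> \<gamma> t"
  unfolding step_size[OF assms(1)] using assms S_nonneg[of "t - 1"]
  by (intro divide_left_mono) auto

text \<open>\<open>B\<close> may depend on \<open>T\<close>: a bound linear in \<open>T\<close>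
  gives order \<open>sqrt T\<close> (bounded operator), a constant gives order \<open>T\<close>
  (Lipschitz operator).\<close>

lemma sum_step_sizes_ge:
  assumes "S T \<le> B"
  shows "real T / sqrt (1 + B) \<le> (\<Sum>t=1..T. \<gamma> t)"
proof -
  have "(\<Sum>t=1..T. 1 / sqrt (1 + B)) \<le> (\<Sum>t=1..T. \<gamma> t)"
  proof (intro sum_mono step_size_ge)
    fix t assume "t \<in> {1..T}"
    then have t: "1 \<le> t" "t - 1 \<le> T" by auto
    show "1 \<le> t" by (fact t)
    show "S (t - 1) \<le> B"
      using S_mono[OF t(2)] assms by linarith
  qed
  then show ?thesis by simp
qed

lemma sum_step_sizes_pos: "T \<ge> 1 \<Longrightarrow> 0 < (\<Sum>t=1..T. \<gamma> t)"
  by (intro sum_pos step_size_pos) auto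

section \<open>Energy inequality and the gap of the ergodic average\<close>

lemma energy:
  assumes "z \<in> X"
  shows "(norm (x (T + 1) - z))\<^sup>2 + 2 * (\<Sum>t=1..T. \<gamma> t * (V (y t) \<bullet> (y t - z)))
     \<le> (norm (x 1 - z))\<^sup>2 + (\<Sum>t=1..T. (\<gamma> t)\<^sup>2 * (\<delta> t)\<^sup>2) - (\<Sum>t=1..T. (norm (x t - y t))\<^sup>2)"
proof (induction T)
  case (Suc T)
  have "(norm (x (Suc T + 1) - z))\<^sup>2 + 2 * (\<gamma> (Suc T) * (V (y (Suc T)) \<bullet> (y (Suc T) - z)))
     \<le> (norm (x (Suc T) - z))\<^sup>2 + (\<gamma> (Suc T))\<^sup>2 * (\<delta> (Suc T))\<^sup>2 - (norm (x (Suc T) - y (Suc T)))\<^sup>2"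
    unfolding \<delta>_def
    using run x_in[of "Suc T"] assms closed_X convex_X
    by (intro extragradient_step[where X = X]) (auto simp: adaptive_extragradient_def)
  with Suc show ?case
    by (simp add: algebra_simps)
qed simp

text \<open>Trading the varying \<open>V (y t)\<close> for the fixed \<open>V z\<close> makes the
  weighted sum affine in the points \<open>y t\<close>, so it can be expressed through their
  average.\<close>

lemma monotone_at:
  assumes "z \<in> X" "t \<ge> 1"
  shows "V z \<bullet> (y t - z) \<le> V (y t) \<bullet> (y t - z)"
  using mono_V y_in[OF assms(2)] assms(1)
  unfolding monotone_operator_on_def by (fastforce simp: inner_diff_left)

lemma ergodic_average_inner:
  assumes "T \<ge> 1"
  shows "(\<Sum>t=1..T. \<gamma> t) * (v \<bullet> (ergodic_average \<gamma> y T - z)) = (\<Sum>t=1..T. \<gamma> t * (v \<bullet> (y t - z)))"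
proof -
  have "(\<Sum>t=1..T. \<gamma> t) *\<^sub>R (ergodic_average \<gamma> y T - z) = (\<Sum>t=1..T. \<gamma> t *\<^sub>R (y t - z))"
    using sum_step_sizes_pos[OF assms]
    by (simp add: ergodic_average_def scaleR_diff_right sum_subtractf scaleR_sum_left)
  then show ?thesis
    by (simp add: inner_sum_right flip: inner_scaleR_right)
qed

lemma ergodic_average_inner_le:
  assumes "z \<in> X" "T \<ge> 1"
  shows "V z \<bullet> (ergodic_average \<gamma> y T - z)
    \<le> ((norm (x 1 - z))\<^sup>2 + (\<Sum>t=1..T. (\<gamma> t)\<^sup>2 * (\<delta> t)\<^sup>2)) / (2 * (\<Sum>t=1..T. \<gamma> t))"
proof -
  have "(\<Sum>t=1..T. \<gamma> t * (V z \<bullet> (y t - z))) \<le> (\<Sum>t=1..T. \<gamma> t * (V (y t) \<bullet> (y t - z)))"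
    using assms less_imp_le[OF step_size_pos] by (intro sum_mono mult_left_mono monotone_at) auto
  \<comment> \<open>The displacements discarded here are what controls \<open>S\<close> in
    \<open>S_bounded_if_Lipschitz\<close>.\<close>
  moreover have "0 \<le> (\<Sum>t=1..T. (norm (x t - y t))\<^sup>2)"
    by (intro sum_nonneg) auto
  moreover have "0 \<le> (norm (x (T + 1) - z))\<^sup>2"
    by simp
  ultimately have "2 * ((\<Sum>t=1..T. \<gamma> t) * (V z \<bullet> (ergodic_average \<gamma> y T - z)))
      \<le> (norm (x 1 - z))\<^sup>2 + (\<Sum>t=1..T. (\<gamma> t)\<^sup>2 * (\<delta> t)\<^sup>2)"
    using energy[OF assms(1), of T] ergodic_average_inner[OF assms(2), of "V z" z] by linarith
  then show ?thesis
    using sum_step_sizes_pos[OF assms(2)] by (simp add: field_simps)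
qed

text \<open>The O-notation concerns absolute values, so a lower bound is required too: the solution
  \<open>xs\<close> lies in \<open>C\<close> and makes the gap nonnegative. \<open>E\<close> and
  \<open>G\<close> stay abstract to serve both rates.\<close>

lemma abs_Gap_le:
  assumes "C \<subseteq> X" "compact C" "xs \<in> C" "VI_solution V X xs" "T \<ge> 1"
    and E: "(\<Sum>t=1..T. (\<gamma> t)\<^sup>2 * (\<delta> t)\<^sup>2) \<le> E" and G: "0 < G" "G \<le> (\<Sum>t=1..T. \<gamma> t)"
  shows "\<bar>Gap V C (ergodic_average \<gamma> y T)\<bar> \<le> ((SUP z\<in>C. (norm (x 1 - z))\<^sup>2) + E) / (2 * G)"
    (is "_ \<le> ?B")
proof -
  have E0: "0 \<le> (\<Sum>t=1..T. (\<gamma> t)\<^sup>2 * (\<delta> t)\<^sup>2)"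
    by (intro sum_nonneg) auto
  have le: "V z \<bullet> (ergodic_average \<gamma> y T - z) \<le> ?B" if "z \<in> C" for z
  proof -
    have "V z \<bullet> (ergodic_average \<gamma> y T - z)
        \<le> ((norm (x 1 - z))\<^sup>2 + (\<Sum>t=1..T. (\<gamma> t)\<^sup>2 * (\<delta> t)\<^sup>2)) / (2 * (\<Sum>t=1..T. \<gamma> t))"
      using assms that by (intro ergodic_average_inner_le) auto
    also have "\<dots> \<le> ?B"
      using norm_le_SUP_on_compact[OF assms(2) that, of "x 1"] E E0 G
      by (intro frac_le) (auto intro: add_nonneg_nonneg add_mono order_trans[OF zero_le_power2])
    finally show ?thesis .
  qed
  have "Gap V C (ergodic_average \<gamma> y T) \<le> ?B"
    unfolding Gap_def using assms(3) le by (intro cSUP_least) auto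
  moreover have "0 \<le> Gap V C (ergodic_average \<gamma> y T)"
  proof -
    have "0 \<le> (\<Sum>t=1..T. \<gamma> t * (V xs \<bullet> (y t - xs)))"
      using assms(4) y_in less_imp_le[OF step_size_pos]
      by (intro sum_nonneg mult_nonneg_nonneg) (auto simp: VI_solution_def)
    then have "0 \<le> V xs \<bullet> (ergodic_average \<gamma> y T - xs)"
      using sum_step_sizes_pos[OF assms(5)] ergodic_average_inner[OF assms(5), of "V xs" xs]
      by (metis zero_le_mult_iff not_less)
    also have "\<dots> \<le> Gap V C (ergodic_average \<gamma> y T)"
      unfolding Gap_def using assms(3) le by (intro cSUP_upper bdd_aboveI2) auto
    finally show ?thesis .
  qed
  ultimately show ?thesis by linarith
qed

section \<open>Growth of \<open>S\<close> for bounded and for Lipschitz operators\<close>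

lemma S_le_if_bounded:
  assumes "\<And>z. z \<in> X \<Longrightarrow> norm (V z) \<le> M"
  shows "S T \<le> 4 * M\<^sup>2 * real T"
    and "(\<Sum>t=1..T. (\<gamma> t)\<^sup>2 * (\<delta> t)\<^sup>2) \<le> (1 + 4 * M\<^sup>2) * ln (1 + 4 * M\<^sup>2 * real T)"
proof -
  have d: "(\<delta> t)\<^sup>2 \<le> 4 * M\<^sup>2" if "t \<ge> 1" for t
  proof -
    have "\<delta> t \<le> 2 * M"
      unfolding \<delta>_def
      using norm_triangle_ineq4[of "V (y t)" "V (x t)"] assms[OF x_in[OF that]] assms[OF y_in[OF that]]
      by linarith
    then have "(\<delta> t)\<^sup>2 \<le> (2 * M)\<^sup>2"
      by (intro power_mono) (auto simp: \<delta>_def)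
    then show ?thesis by (simp add: power_mult_distrib)
  qed
  have "S T \<le> (\<Sum>t=1..T. 4 * M\<^sup>2)"
    unfolding S_def by (intro sum_mono d) auto
  then show *: "S T \<le> 4 * M\<^sup>2 * real T"
    by (simp add: mult_ac)
  have "(\<Sum>t=1..T. (\<gamma> t)\<^sup>2 * (\<delta> t)\<^sup>2) = (\<Sum>t=1..T. (\<delta> t)\<^sup>2 / (1 + (\<Sum>s=1..t-1. (\<delta> s)\<^sup>2)))"
    by (intro sum.cong) (auto simp: step_size_squared S_def)
  also have "\<dots> \<le> (1 + 4 * M\<^sup>2) * ln (1 + (\<Sum>s=1..T. (\<delta> s)\<^sup>2))"
    by (rule sum_relative_increments_le_ln) (simp add: d)
  also have "\<dots> \<le> (1 + 4 * M\<^sup>2) * ln (1 + 4 * M\<^sup>2 * real T)"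
    using * S_nonneg[of T] by (intro mult_left_mono) (auto simp: S_def)
  finally show "(\<Sum>t=1..T. (\<gamma> t)\<^sup>2 * (\<delta> t)\<^sup>2) \<le> (1 + 4 * M\<^sup>2) * ln (1 + 4 * M\<^sup>2 * real T)" .
qed

text \<open>The bound is not explicit: it may depend on the run through an index \<open>t0\<close>
  where \<open>S\<close> has reached \<open>2 * L\<^sup>2\<close>. It is independent of
  \<open>T\<close>, as the O-notation demands.\<close>

lemma S_bounded_if_Lipschitz:
  assumes "L > 0" "L-lipschitz_on X V" "VI_solution V X xs"
  obtains B where "0 \<le> B" "\<And>T. S T \<le> B"
proof (cases "\<exists>t0. 2 * L\<^sup>2 \<le> S t0")
  case False
  then show ?thesis
    by (intro that[of "2 * L\<^sup>2"]) (auto simp: not_le intro: less_imp_le)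
next
  case True
  then obtain t0 where t0: "2 * L\<^sup>2 \<le> S t0" by blast
  define D where "D = (norm (x 1 - xs))\<^sup>2"
  \<comment> \<open>The energy inequality offers the coefficient \<open>1 / L\<^sup>2\<close>. One
    half goes into \<open>f\<close>, which is nonnegative after \<open>t0\<close> by the choice of
    the threshold; the other half bounds \<open>S T\<close>.\<close>
  define f where "f t = (1 / (2 * L\<^sup>2) - (\<gamma> t)\<^sup>2) * (\<delta> t)\<^sup>2" for t
  have xs: "xs \<in> X" using assms by (simp add: VI_solution_def)
  have bound: "S T \<le> 2 * L\<^sup>2 * (D - (\<Sum>t=1..t0. f t))" if "t0 \<le> T" for T
  proof -
    have "(\<delta> t)\<^sup>2 / L\<^sup>2 \<le> (norm (x t - y t))\<^sup>2" if "t \<ge> 1" for t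
    proof -
      have "\<delta> t \<le> L * norm (x t - y t)"
        using lipschitz_onD[OF assms(2) x_in[OF that] y_in[OF that]]
        by (simp add: \<delta>_def dist_norm norm_minus_commute)
      then have "(\<delta> t)\<^sup>2 \<le> (L * norm (x t - y t))\<^sup>2"
        by (intro power_mono) (auto simp: \<delta>_def)
      then show ?thesis
        using assms(1) by (simp add: field_simps power_mult_distrib)
    qed
    then have "(\<Sum>t=1..T. (\<delta> t)\<^sup>2 / L\<^sup>2) \<le> (\<Sum>t=1..T. (norm (x t - y t))\<^sup>2)"
      by (intro sum_mono) auto
    moreover have "0 \<le> (\<Sum>t=1..T. \<gamma> t * (V (y t) \<bullet> (y t - xs)))"
    proof (intro sum_nonneg mult_nonneg_nonneg)
      fix t assume "t \<in> {1..T}"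
      then have t: "t \<ge> 1" by simp
      have "0 \<le> V xs \<bullet> (y t - xs)"
        using assms(3) y_in[OF t] by (simp add: VI_solution_def)
      then show "0 \<le> V (y t) \<bullet> (y t - xs)"
        using monotone_at[OF xs t] by linarith
      show "0 \<le> \<gamma> t"
        using step_size_pos[OF t] by simp
    qed
    moreover have "0 \<le> (norm (x (T + 1) - xs))\<^sup>2" by simp
    ultimately have "S T / L\<^sup>2 \<le> D + (\<Sum>t=1..T. (\<gamma> t)\<^sup>2 * (\<delta> t)\<^sup>2)"
      using energy[OF xs, of T] unfolding D_def S_def sum_divide_distrib by linarith
    moreover have "(\<Sum>t=1..T. f t) = S T / (2 * L\<^sup>2) - (\<Sum>t=1..T. (\<gamma> t)\<^sup>2 * (\<delta> t)\<^sup>2)"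
      unfolding f_def S_def by (simp add: left_diff_distrib sum_subtractf sum_divide_distrib)
    moreover have "S T / L\<^sup>2 = S T / (2 * L\<^sup>2) + S T / (2 * L\<^sup>2)"
      by (simp add: field_simps)
    moreover have "(\<Sum>t=1..t0. f t) \<le> (\<Sum>t=1..T. f t)"
    proof (rule sum_mono2)
      fix t assume t: "t \<in> {1..T} - {1..t0}"
      then have "t0 \<le> t - 1" by auto
      then have "2 * L\<^sup>2 \<le> 1 + S (t - 1)"
        using t0 S_mono[of t0 "t - 1"] by linarith
      then have "(\<gamma> t)\<^sup>2 \<le> 1 / (2 * L\<^sup>2)"
        using t assms(1) S_nonneg[of "t - 1"]
        by (subst step_size_squared) (auto intro!: divide_left_mono mult_pos_pos)
      then show "0 \<le> f t"
        unfolding f_def by simp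
    qed (use that in auto)
    ultimately have "S T / (2 * L\<^sup>2) \<le> D - (\<Sum>t=1..t0. f t)"
      by linarith
    then show ?thesis
      using assms(1) by (simp add: pos_divide_le_eq mult.commute)
  qed
  show ?thesis
  proof (rule that)
    fix T
    show "S T \<le> 2 * L\<^sup>2 * (D - (\<Sum>t=1..t0. f t))"
      \<comment> \<open>Monotonicity of \<open>S\<close> extends the bound to
        \<open>T < t0\<close>.\<close>
      using bound[of "max t0 T"] S_mono[of T "max t0 T"] by simp
    show "0 \<le> 2 * L\<^sup>2 * (D - (\<Sum>t=1..t0. f t))"
      using bound[of t0] S_nonneg[of t0] by simp
  qed
qed

end

section \<open>The two convergence rates\<close>

theorem theorem1:
  fixes \<X> \<C> :: "'a::euclidean_space set"
    and V :: "'a \<Rightarrow> 'a"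
    and xs :: 'a
    and x y :: "nat \<Rightarrow> 'a"
    and \<gamma> :: "nat \<Rightarrow> real"
    and H :: real
  assumes "\<X> \<noteq> {}" "closed \<X>" "convex \<X>"
    and "monotone_operator_on \<X> V"
    and "VI_solution V \<X> xs"
    and "\<C> \<subseteq> \<X>" "convex \<C>" "compact \<C>"
    and "xs \<in> top_of_set \<X> interior_of \<C>"
    and "adaptive_extragradient V \<X> x y \<gamma>"
    and "H = (SUP z\<in>\<C>. (norm (x 1 - z))\<^sup>2)"
  shows "(\<forall>M>0. (\<forall>z\<in>\<X>. norm (V z) \<le> M) \<longrightarrow>
           (\<lambda>T. Gap V \<C> (ergodic_average \<gamma> y T))
             \<in> O(\<lambda>T. (H + 4 * M ^ 3 + ln (1 + 4 * M\<^sup>2 * real T)) / sqrt (real T))) \<and>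
         (\<forall>L>0. L-lipschitz_on \<X> V \<longrightarrow>
           (\<lambda>T. Gap V \<C> (ergodic_average \<gamma> y T)) \<in> O(\<lambda>T. H / real T))"
proof (intro conjI allI impI)
  interpret adaptive_extragradient_run \<X> V x y \<gamma>
    by (rule adaptive_extragradient_run.intro) (fact assms)+
  have xsC: "xs \<in> \<C>"
    using assms(9) interior_of_subset[of "top_of_set \<X>" \<C>] by (rule rev_subsetD)
  have H: "(norm (x 1 - z))\<^sup>2 \<le> H" if "z \<in> \<C>" for z
    using norm_le_SUP_on_compact[OF assms(8) that] assms(11) by simp
  have H0: "0 \<le> H"
    using H[OF xsC] by (rule order_trans[OF zero_le_power2])
  note Gap_le = abs_Gap_le[OF assms(6) assms(8) xsC assms(5), folded assms(11)]
  {
    fix M :: real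
    assume M: "M > 0" "\<forall>z\<in>\<X>. norm (V z) \<le> M"
    define K where "K = 1 + 4 * M\<^sup>2"
    have K: "K \<ge> 1" by (simp add: K_def)
    show "(\<lambda>T. Gap V \<C> (ergodic_average \<gamma> y T))
             \<in> O(\<lambda>T. (H + 4 * M ^ 3 + ln (1 + 4 * M\<^sup>2 * real T)) / sqrt (real T))"
    \<comment> \<open>\<open>sqrt K\<close> comes from the sum of the step sizes, via
      \<open>1 + 4 * M\<^sup>2 * real T \<le> K * real T\<close> for \<open>T \<ge> 1\<close>; the
      other \<open>K\<close> is the factor of the logarithm.\<close>
    proof (rule bigoI[where c = "K * sqrt K"], rule eventually_sequentiallyI[of 1])
      fix T :: nat
      assume T: "1 \<le> T"
      define l where "l = ln (1 + 4 * M\<^sup>2 * real T)"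
      have l: "0 \<le> l" by (simp add: l_def)
      have "1 + 4 * M\<^sup>2 * real T \<le> K * real T"
        using T by (simp add: K_def algebra_simps)
      then have "sqrt (1 + 4 * M\<^sup>2 * real T) \<le> sqrt K * sqrt (real T)"
        by (simp flip: real_sqrt_mult)
      moreover have "0 < sqrt (1 + 4 * M\<^sup>2 * real T)"
        by (simp add: add_pos_nonneg)
      ultimately have "real T / (sqrt K * sqrt (real T)) \<le> real T / sqrt (1 + 4 * M\<^sup>2 * real T)"
        using T K by (intro divide_left_mono) auto
      also have "\<dots> \<le> (\<Sum>t=1..T. \<gamma> t)"
        using M by (intro sum_step_sizes_ge S_le_if_bounded) auto
      also have "real T / (sqrt K * sqrt (real T)) = sqrt (real T) / sqrt K"
        by (metis divide_divide_eq_left' of_nat_0_le_iff real_div_sqrt)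
      finally have G: "sqrt (real T) / sqrt K \<le> (\<Sum>t=1..T. \<gamma> t)" .
      have "0 < sqrt (real T) / sqrt K"
        using T K by simp
      with G have "\<bar>Gap V \<C> (ergodic_average \<gamma> y T)\<bar> \<le> (H + K * l) / (2 * (sqrt (real T) / sqrt K))"
        using M T unfolding K_def l_def by (intro Gap_le S_le_if_bounded) auto
      also have "\<dots> = sqrt K / sqrt (real T) * ((H + K * l) / 2)"
        by (simp add: mult.commute)
      also have "\<dots> \<le> sqrt K / sqrt (real T) * (K * (H + 4 * M ^ 3 + l))"
      proof (rule mult_left_mono)
        have "1 * H \<le> K * H"
          using K H0 by (rule mult_right_mono)
        moreover have "0 \<le> K * l" "0 \<le> K * (4 * M ^ 3)" "0 \<le> K * H"
          using K H0 l M by auto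
        ultimately show "(H + K * l) / 2 \<le> K * (H + 4 * M ^ 3 + l)"
          by (simp add: algebra_simps)
      qed (use K in auto)
      also have "\<dots> = K * sqrt K * norm ((H + 4 * M ^ 3 + l) / sqrt (real T))"
        using H0 l M by simp
      finally show "norm (Gap V \<C> (ergodic_average \<gamma> y T))
          \<le> K * sqrt K * norm ((H + 4 * M ^ 3 + ln (1 + 4 * M\<^sup>2 * real T)) / sqrt (real T))"
        by (simp add: l_def)
    qed
  next
    fix L :: real
    assume L: "L > 0" "L-lipschitz_on \<X> V"
    show "(\<lambda>T. Gap V \<C> (ergodic_average \<gamma> y T)) \<in> O(\<lambda>T. H / real T)"
    \<comment> \<open>For \<open>H = 0\<close> the comparison function vanishes and the gap must
      eventually be exactly zero; otherwise the constant may contain \<open>1 / H\<close>.\<close>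
    proof (cases "H = 0")
      case True
      have "z = x 1" if "z \<in> \<C>" for z
        using H[OF that] True by simp
      then have "\<C> = {xs}"
        using xsC by blast
      then have X: "\<X> = {xs}"
        using interior_of_singleton_convex[OF assms(3)] assms(9) by simp
      have "Gap V \<C> (ergodic_average \<gamma> y T) = 0" if "T \<ge> 1" for T
      proof -
        have "(\<Sum>t=1..T. \<gamma> t * (V xs \<bullet> (y t - xs))) = 0"
          using y_in X by (intro sum.neutral) auto
        then show ?thesis
          using ergodic_average_inner[OF that, of "V xs" xs] sum_step_sizes_pos[OF that]
          by (simp add: Gap_def \<open>\<C> = {xs}\<close>)
      qed
      then show ?thesis
        by (intro bigoI[where c = 1] eventually_sequentiallyI[of 1]) auto
    next
      case False
      obtain B where B: "0 \<le> B" "\<And>T. S T \<le> B"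
        using S_bounded_if_Lipschitz[OF L assms(5)] by blast
      show ?thesis
      proof (rule bigoI[where c = "(H + B) * sqrt (1 + B) / (2 * H)"], rule eventually_sequentiallyI[of 1])
        fix T :: nat
        assume T: "1 \<le> T"
        \<comment> \<open>Step sizes at most 1 reduce the error sum to \<open>S T\<close>, so the
          same \<open>B\<close> controls both the numerator and the step sizes.\<close>
        have "(\<Sum>t=1..T. (\<gamma> t)\<^sup>2 * (\<delta> t)\<^sup>2) \<le> (\<Sum>t=1..T. 1 * (\<delta> t)\<^sup>2)"
          by (intro sum_mono mult_right_mono step_size_squared_le_1) auto
        also have "\<dots> \<le> B"
          using B(2)[of T] by (simp add: S_def)
        finally have "\<bar>Gap V \<C> (ergodic_average \<gamma> y T)\<bar> \<le> (H + B) / (2 * (real T / sqrt (1 + B)))"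
          using T B by (intro Gap_le sum_step_sizes_ge) auto
        also have "\<dots> = (H + B) * sqrt (1 + B) / (2 * H) * norm (H / real T)"
          using False H0 T by (simp add: divide_simps)
        finally show "norm (Gap V \<C> (ergodic_average \<gamma> y T))
            \<le> (H + B) * sqrt (1 + B) / (2 * H) * norm (H / real T)"
          by simp
      qed
    qed
  }
qed

end
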